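(* Let $r\ge0$ be an integer, let $m_1,\ldots,m_r$ be positive integers, and put $m:=m_1+\cdots+m_r$. Let $p\in\{0,1\}$, let $n$ be an arbitrary complex number, and let $f_1,\ldots,f_r$ be complex numbers, none a non-positive integer. Set $$a=n+\tfrac12p,\qquad b=-n+\tfrac12p,\qquad c=p+\tfrac12+m,$$ and let $\hat Q_m(t)$ be the polynomial defined in the context from these $a,b,c$ and $(f_j),(m_j)$. Assume $(c-a-m)_m\ne0$ and $(c-b-m)_m\neq0$ (so that $\hat Q_m$ is defined) and that $\hat Q_m$ has degree $m$; let $\eta_1,\ldots,\eta_m$ be its zeros counted with multiplicity (all nonzero, since $\hat Q_m(0)=1$). Then, for $|x|<1$, $$ (1-x^2)^{-1/2}\,{}_{r+2}F_{r+1}\left[\begin{array}{c}-n+\frac12p,\ n+\frac12p,\ f_1+m_1,\ldots,f_r+m_r\\ p+\frac12+m,\ f_1,\ldots,f_r\end{array};x^2\right] ={}_{m+2}F_{m+1}\left[\begin{array}{c}\frac12+\frac12p-n,\ \frac12+\frac12p+n,\ \eta_1+1,\ldots,\eta_m+1\\ p+\frac12+m,\ \eta_1,\ldots,\eta_m\end{array};x^2\right]. $$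
   Context: Notation. $(x)_k$ is the Pochhammer symbol: $(x)_0=1$, $(x)_k=x(x+1)\cdots(x+k-1)$ for $k\ge1$. The generalized hypergeometric series is $${}_pF_q\left[\begin{array}{c}a_1,\ldots,a_p\\ b_1,\ldots,b_q\end{array};z\right]=\sum_{k\ge0}\frac{(a_1)_k\cdots(a_p)_k}{(b_1)_k\cdots(b_q)_k}\frac{z^k}{k!}.$$ When a numerator parameter is $-N$ with $N$ a non-negative integer, the series is the finite sum over $0\le k\le N$. Empty products equal $1$ and empty parameter lists (case $r=0$, $m=0$) are allowed. The power $(1-x^2)^{-1/2}$ is the principal branch. Coefficients $C_{k,r}$. Let $\Lambda=(f_1)_{m_1}\cdots(f_r)_{m_r}$ and define $\sigma_0,\ldots,\sigma_m$ by the polynomial identity $(f_1+x)_{m_1}\cdots(f_r+x)_{m_r}=\sum_{j=0}^m\sigma_jx^j$. For $0\le k\le m$ set $$C_{k,r}=\frac1\Lambda\sum_{j=k}^m\sigma_j\,\mathbf S_j^{(k)},$$ where $\mathbf S_j^{(k)}$ is the Stirling number of the second kind (so $C_{0,r}=1$ and $C_{m,r}=1/\Lambda$). Polynomial $\hat Q_m$. Given $a,b,c$, for $0\le k\le m$ put $$G_{m,k}(t)={}_3F_2\left[\begin{array}{c}-m+k,\ t+k,\ c-a-b-m\\ c-a-m+k,\ c-b-m+k\end{array};1\right],$$ a finite sum over indices $0,\ldots,m-k$, hence a polynomial in $t$, and $$\hat Q_m(t)=\sum_{k=0}^m\frac{(-1)^kC_{k,r}\,(a)_k(b)_k(t)_k}{(c-a-m)_k(c-b-m)_k}\,G_{m,k}(t).$$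 It satisfies $\hat Q_m(0)=1$. Convention: in the series with parameters $\eta_j+1$ over $\eta_j$, each quotient $(\eta_j+1)_k/(\eta_j)_k$ is understood as $(\eta_j+k)/\eta_j$. *)

theory Defs
  imports "HOL-Analysis.Analysis" "HOL-Combinatorics.Stirling"
begin

definition hyp_term :: "complex list \<Rightarrow> complex list \<Rightarrow> complex \<Rightarrow> nat \<Rightarrow> complex" where
  "hyp_term as bs z k =
     (\<Prod>a\<leftarrow>as. pochhammer a k) / (\<Prod>b\<leftarrow>bs. pochhammer b k) * (z ^ k / fact k)"

definition hypF :: "complex list \<Rightarrow> complex list \<Rightarrow> complex \<Rightarrow> complex" where
  "hypF as bs z = (\<Sum>k. hyp_term as bs z k)"

text \<open>The series with numerator parameters \<open>as\<close>, \<open>\<eta> + 1\<close> and denominator parameters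
  \<open>bs\<close>, \<open>\<eta>\<close> (\<open>\<eta>\<close> ranging over \<open>etas\<close>). The quotient of the Pochhammer symbols of \<open>\<eta> + 1\<close>
  and \<open>\<eta>\<close> is read as \<open>(\<eta> + k) / \<eta>\<close>, so \<open>\<eta>\<close> may be a negative integer.\<close>

definition hyp_unit_shift_term ::
    "complex list \<Rightarrow> complex list \<Rightarrow> complex list \<Rightarrow> complex \<Rightarrow> nat \<Rightarrow> complex" where
  "hyp_unit_shift_term as bs etas z k =
     hyp_term as bs z k * (\<Prod>\<eta>\<leftarrow>etas. (\<eta> + of_nat k) / \<eta>)"

definition hypF_unit_shift ::
    "complex list \<Rightarrow> complex list \<Rightarrow> complex list \<Rightarrow> complex \<Rightarrow> complex" where
  "hypF_unit_shift as bs etas z = (\<Sum>k. hyp_unit_shift_term as bs etas z k)"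

text \<open>In the following, \<open>fs\<close> and \<open>ms\<close> list the parameters \<open>f\<^sub>j\<close> and \<open>m\<^sub>j\<close>, and \<open>m\<close> is
  \<open>sum_list ms\<close>.\<close>

definition Lam :: "complex list \<Rightarrow> nat list \<Rightarrow> complex" where
  "Lam fs ms = (\<Prod>(f, l)\<leftarrow>zip fs ms. pochhammer f l)"

definition sigma :: "complex list \<Rightarrow> nat list \<Rightarrow> nat \<Rightarrow> complex" where
  "sigma fs ms j = coeff (\<Prod>(f, l)\<leftarrow>zip fs ms. pochhammer [:f, 1:] l) j"

definition C_coeff :: "complex list \<Rightarrow> nat list \<Rightarrow> nat \<Rightarrow> complex" where
  "C_coeff fs ms k =
     1 / Lam fs ms * (\<Sum>j = k..sum_list ms. sigma fs ms j * of_nat (Stirling j k))"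

definition G_fun ::
    "complex \<Rightarrow> complex \<Rightarrow> complex \<Rightarrow> nat \<Rightarrow> nat \<Rightarrow> complex \<Rightarrow> complex" where
  "G_fun a b c m k t =
     (\<Sum>i\<le>m - k. hyp_term
        [- of_nat m + of_nat k, t + of_nat k, c - a - b - of_nat m]
        [c - a - of_nat m + of_nat k, c - b - of_nat m + of_nat k] 1 i)"

definition Q_fun ::
    "complex \<Rightarrow> complex \<Rightarrow> complex \<Rightarrow> complex list \<Rightarrow> nat list \<Rightarrow> complex \<Rightarrow> complex" where
  "Q_fun a b c fs ms t = (let m = sum_list ms in
     \<Sum>k\<le>m. (-1) ^ k * C_coeff fs ms k * pochhammer a k * pochhammer b k * pochhammer t k
       / (pochhammer (c - a - of_nat m) k * pochhammer (c - b - of_nat m) k)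
       * G_fun a b c m k t)"

text \<open>\<open>G_fun\<close> and \<open>Q_fun\<close> as formal polynomials in \<open>t\<close>; see \<open>poly_G_poly\<close> and \<open>poly_Q_poly\<close>.\<close>

definition G_poly :: "complex \<Rightarrow> complex \<Rightarrow> complex \<Rightarrow> nat \<Rightarrow> nat \<Rightarrow> complex poly" where
  "G_poly a b c m k =
     (\<Sum>i\<le>m - k. smult (hyp_term
        [- of_nat m + of_nat k, c - a - b - of_nat m]
        [c - a - of_nat m + of_nat k, c - b - of_nat m + of_nat k] 1 i)
        (pochhammer [:of_nat k, 1:] i))"

definition Q_poly ::
    "complex \<Rightarrow> complex \<Rightarrow> complex \<Rightarrow> complex list \<Rightarrow> nat list \<Rightarrow> complex poly" where
  "Q_poly a b c fs ms = (let m = sum_list ms in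
     \<Sum>k\<le>m. smult ((-1) ^ k * C_coeff fs ms k * pochhammer a k * pochhammer b k
       / (pochhammer (c - a - of_nat m) k * pochhammer (c - b - of_nat m) k))
       (pochhammer [:0, 1:] k * G_poly a b c m k))"

lemma poly_pochhammer: "poly (pochhammer p k) (t :: complex) = pochhammer (poly p t) k"
  by (simp add: pochhammer_prod poly_prod)

lemma poly_G_poly: "poly (G_poly a b c m k) t = G_fun a b c m k t"
  by (simp add: G_poly_def G_fun_def hyp_term_def poly_sum poly_pochhammer add.commute mult_ac)

lemma poly_Q_poly: "poly (Q_poly a b c fs ms) t = Q_fun a b c fs ms t"
  by (simp add: Q_poly_def Q_fun_def Let_def poly_sum poly_pochhammer poly_G_poly mult_ac)

lemma hyp_term_terminating:
  assumes "N < k"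
  shows "hyp_term (- of_nat N # as) bs z k = 0"
  using assms by (simp add: hyp_term_def pochhammer_of_nat_eq_0_iff)

lemma G_fun_eq_hypF:
  assumes "k \<le> m"
  shows "G_fun a b c m k t = hypF
        [- of_nat m + of_nat k, t + of_nat k, c - a - b - of_nat m]
        [c - a - of_nat m + of_nat k, c - b - of_nat m + of_nat k] 1"
proof -
  have eq: "- of_nat m + of_nat k = (- of_nat (m - k) :: complex)"
    using assms by (simp add: of_nat_diff)
  show ?thesis
    unfolding hypF_def G_fun_def eq
    by (rule suminf_finite[symmetric]) (simp_all add: hyp_term_terminating)
qed

text \<open>The series below converge for \<open>norm z < 1\<close>, so \<open>hypF\<close> and \<open>hypF_unit_shift\<close> are genuine
  sums there.\<close>

lemma tendsto_prod_list_1: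
  fixes g :: "'a \<Rightarrow> nat \<Rightarrow> complex"
  assumes "\<And>x. x \<in> set xs \<Longrightarrow> g x \<longlonglongrightarrow> 1"
  shows "(\<lambda>k. \<Prod>x\<leftarrow>xs. g x k) \<longlonglongrightarrow> 1"
  using assms
proof (induction xs)
  case (Cons x xs)
  then have "(\<lambda>k. g x k * (\<Prod>x\<leftarrow>xs. g x k)) \<longlonglongrightarrow> 1 * 1"
    by (intro tendsto_mult) auto
  then show ?case by simp
qed simp

lemma prod_list_divide_const:
  "(\<Prod>x\<leftarrow>xs. g x / (d :: complex)) = (\<Prod>x\<leftarrow>xs. g x) / d ^ length xs"
  by (induction xs) auto

lemma prod_list_mult: "(\<Prod>x\<leftarrow>xs. g x * (h x :: complex)) = (\<Prod>x\<leftarrow>xs. g x) * (\<Prod>x\<leftarrow>xs. h x)"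
  by (induction xs) auto

lemma shift_ratio_tendsto: "(\<lambda>k. (a + of_nat k) / of_nat (Suc k)) \<longlonglongrightarrow> (1 :: complex)"
proof -
  have "(\<lambda>k. 1 + (a - 1) * inverse (of_nat (Suc k))) \<longlonglongrightarrow> 1 + (a - 1) * (0 :: complex)"
    by (intro tendsto_intros LIMSEQ_Suc[OF lim_inverse_n])
  moreover have "1 + (a - 1) * inverse (of_nat (Suc k)) = (a + of_nat k) / of_nat (Suc k)" for k
  proof -
    have "(of_nat (Suc k) :: complex) \<noteq> 0" by (rule of_nat_neq_0)
    then have "1 + (a - 1) * inverse (of_nat (Suc k)) = (of_nat (Suc k) + (a - 1)) / of_nat (Suc k)"
      by (simp add: distrib_right divide_inverse del: of_nat_Suc)
    then show ?thesis by simp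
  qed
  ultimately show ?thesis by simp
qed

lemma summable_hyp_unit_shift_term:
  assumes len: "length as = Suc (length bs)" and z: "norm z < 1"
  shows "summable (hyp_unit_shift_term as bs etas z)"
proof -
  define P where "P xs k = (\<Prod>x\<leftarrow>xs. (x + of_nat k) / of_nat (Suc k))" for xs :: "complex list" and k
  define E where "E k = (\<Prod>\<eta>\<leftarrow>etas. (\<eta> + of_nat (Suc k)) / (\<eta> + of_nat k))" for k
  define R where "R k = P as k / P bs k * z * E k" for k
  have P: "P xs \<longlonglongrightarrow> 1" for xs
    unfolding P_def by (intro tendsto_prod_list_1 shift_ratio_tendsto)
  have E: "E \<longlonglongrightarrow> 1"
    unfolding E_def
  proof (intro tendsto_prod_list_1)
    fix \<eta> :: complex
    have "(\<lambda>k. ((\<eta> + 1) + of_nat k) / of_nat (Suc k) / ((\<eta> + of_nat k) / of_nat (Suc k)))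
            \<longlonglongrightarrow> 1 / 1"
      by (intro tendsto_divide shift_ratio_tendsto) auto
    then show "(\<lambda>k. (\<eta> + of_nat (Suc k)) / (\<eta> + of_nat k)) \<longlonglongrightarrow> 1"
      by (simp add: add_ac del: of_nat_Suc) (simp add: add_ac)
  qed
  have "R \<longlonglongrightarrow> 1 / 1 * z * 1"
    unfolding R_def by (intro tendsto_intros P E) auto
  then have nR: "(\<lambda>k. norm (R k)) \<longlonglongrightarrow> norm z"
    by (auto intro: tendsto_norm)
  obtain q where q: "norm z < q" "q < 1" using z dense by blast
  have ev0: "\<forall>\<^sub>F k in sequentially. norm (R k) < q"
    using nR q(1) by (rule order_tendstoD)
  have ev1: "\<forall>\<^sub>F k in sequentially. \<forall>\<eta>\<in>set etas. \<eta> + of_nat k \<noteq> 0"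
  proof (rule eventually_ball_finite)
    show "\<forall>\<eta>\<in>set etas. \<forall>\<^sub>F k in sequentially. \<eta> + of_nat k \<noteq> 0"
    proof
      fix \<eta> :: complex
      obtain N :: nat where N: "norm \<eta> < of_nat N" using reals_Archimedean2 by blast
      have "\<eta> + of_nat k \<noteq> 0" if "k \<ge> N" for k
      proof
        assume "\<eta> + of_nat k = 0"
        then have "norm \<eta> = of_nat k" by (metis add_eq_0_iff norm_minus_cancel norm_of_nat)
        with N that show False by simp
      qed
      then show "\<forall>\<^sub>F k in sequentially. \<eta> + of_nat k \<noteq> 0"
        unfolding eventually_sequentially by blast
    qed
  qed simp
  have step: "hyp_unit_shift_term as bs etas z (Suc k) = hyp_unit_shift_term as bs etas z k * R k"
    if "\<forall>\<eta>\<in>set etas. \<eta> + of_nat k \<noteq> 0" for k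
  proof -
    have "(\<Prod>\<eta>\<leftarrow>etas. (\<eta> + of_nat (Suc k)) / \<eta>) = (\<Prod>\<eta>\<leftarrow>etas. (\<eta> + of_nat k) / \<eta>) * E k"
      unfolding E_def prod_list_mult[symmetric]
      using that by (intro arg_cong[of _ _ prod_list] map_cong) auto
    moreover have "hyp_term as bs z (Suc k) = hyp_term as bs z k * (P as k / P bs k * z)"
    proof -
      have "(of_nat (Suc k) :: complex) \<noteq> 0" by (rule of_nat_neq_0)
      then show ?thesis
        unfolding hyp_term_def P_def prod_list_divide_const pochhammer_Suc prod_list_mult
        by (simp add: len mult_ac del: of_nat_Suc)
    qed
    ultimately show ?thesis by (simp add: hyp_unit_shift_term_def R_def mult_ac)
  qed
  from ev0 ev1 have
    "\<forall>\<^sub>F k in sequentially. norm (hyp_unit_shift_term as bs etas z (Suc k))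
        \<le> q * norm (hyp_unit_shift_term as bs etas z k)"
  proof eventually_elim
    case (elim k)
    show ?case
      unfolding step[OF elim(2)] norm_mult
      using mult_left_mono[OF less_imp_le[OF elim(1)], of "norm (hyp_unit_shift_term as bs etas z k)"]
      by (simp add: mult.commute)
  qed
  then obtain N where "\<And>k. k \<ge> N \<Longrightarrow> norm (hyp_unit_shift_term as bs etas z (Suc k))
        \<le> q * norm (hyp_unit_shift_term as bs etas z k)"
    unfolding eventually_sequentially by blast
  with q(2) show ?thesis by (rule summable_ratio_test)
qed

lemma summable_hyp_term:
  assumes "length as = Suc (length bs)" "norm z < 1"
  shows "summable (hyp_term as bs z)"
  using summable_hyp_unit_shift_term[OF assms, of "[]"]
  by (simp add: hyp_unit_shift_term_def[abs_def])

end

theory Submission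
  imports Defs "HOL-Computational_Algebra.Fundamental_Theorem_Algebra"
begin

text \<open>Put \<open>s = c - a - b - m\<close>, which equals \<open>1 / 2\<close> in the theorem, and compare coefficients of
  powers of \<open>z = x\<^sup>2\<close> in the Cauchy product of \<open>(1 - z) powr (- s)\<close> with the series on the left.
  Expanding the quotients of Pochhammer symbols of the \<open>f\<^sub>j\<close> in falling factorials of the summation
  index splits that series into a combination, with weights \<open>C_coeff\<close>, of shifted Gauss series
  with parameters \<open>a + j\<close>, \<open>b + j\<close>, \<open>c + j\<close>. For each of these the product is evaluated by a
  generalisation of Saalschuetz's sum in which the balancing condition is violated by \<open>M = m - j\<close>;
  the result is the term of index \<open>j\<close> of \<open>Q_fun\<close>, taken at minus the power of \<open>z\<close>. Finally, a polynomial
  \<open>Q\<close> with \<open>Q 0 = 1\<close> and zeros \<open>\<eta>\<close> satisfies \<open>Q (- k) = (\<Prod>\<eta>. (\<eta> + k) / \<eta>)\<close>.\<close>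

section \<open>Summation identities of Vandermonde and Saalschuetz type\<close>

lemma sum_triangle_reindex:
  fixes g :: "nat \<Rightarrow> nat \<Rightarrow> 'a::comm_monoid_add"
  shows "(\<Sum>i\<le>n. \<Sum>k\<le>i. g i k) = (\<Sum>k\<le>n. \<Sum>j\<le>n - k. g (k + j) k)"
  unfolding sum.Sigma[OF finite_atMost ballI[OF finite_atMost]]
  by (rule sum.reindex_bij_witness[of _ "\<lambda>(k, j). (k + j, k)" "\<lambda>(i, k). (k, i - k)"]) auto

lemma pochhammer_Vandermonde:
  fixes x y :: "'a::field_char_0"
  shows "pochhammer (x + y) n / fact n
    = (\<Sum>k\<le>n. pochhammer x k / fact k * (pochhammer y (n - k) / fact (n - k)))"
  by (simp add: pochhammer_binomial_sum sum_divide_distrib binomial_fact mult_ac)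

text \<open>For each \<open>k < n\<close> the symbol
  \<open>pochhammer (y + of_nat k) (n - k)\<close> ends in the factor \<open>y + n - 1\<close>. So
  it is \<open>fact (n - k)\<close> times a binomial coefficient whose upper entry is free of
  \<open>k\<close>, and Vandermonde's convolution applies.\<close>

lemma pochhammer_add_gbinomial:
  fixes x y :: "'a::field_char_0"
  shows "pochhammer (x + y) n / fact n
    = (\<Sum>k\<le>n. (x gchoose k) * (pochhammer (y + of_nat k) (n - k) / fact (n - k)))"
proof -
  have "(x gchoose k) * (pochhammer (y + of_nat k) (n - k) / fact (n - k))
      = (x gchoose k) * ((y + of_nat n - 1) gchoose (n - k))" if "k \<le> n" for k
    using that by (simp add: gbinomial_pochhammer' of_nat_diff)
  then have "(\<Sum>k\<le>n. (x gchoose k) * (pochhammer (y + of_nat k) (n - k) / fact (n - k)))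
      = (x + (y + of_nat n - 1)) gchoose n"
    by (simp add: atLeast0AtMost flip: gbinomial_Vandermonde)
  then show ?thesis
    by (simp add: gbinomial_pochhammer' algebra_simps)
qed

text \<open>Expanding the last factor by Vandermonde in the parameters \<open>\<beta> + s\<close> and \<open>\<alpha> + (n - i)\<close>
  leaves two nested Vandermonde sums.\<close>

lemma Saalschuetz:
  fixes s \<alpha> \<beta> :: "'a::field_char_0"
  shows "(\<Sum>i\<le>n. pochhammer s i / fact i * (pochhammer \<alpha> (n - i) * pochhammer \<beta> (n - i) / fact (n - i))
            * pochhammer (\<alpha> + \<beta> + s + of_nat (n - i)) i)
    = pochhammer (\<alpha> + s) n * pochhammer (\<beta> + s) n / fact n"
proof -
  let ?g = "\<lambda>i k. pochhammer s i * (pochhammer \<alpha> (n - i) * pochhammer \<beta> (n - i) / fact (n - i))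
            * (pochhammer (\<beta> + s) k / fact k * (pochhammer (\<alpha> + of_nat (n - i)) (i - k) / fact (i - k)))"
  have "(\<Sum>i\<le>n. pochhammer s i / fact i * (pochhammer \<alpha> (n - i) * pochhammer \<beta> (n - i) / fact (n - i))
            * pochhammer (\<alpha> + \<beta> + s + of_nat (n - i)) i) = (\<Sum>i\<le>n. \<Sum>k\<le>i. ?g i k)"
  proof (rule sum.cong)
    fix i
    have "pochhammer (\<alpha> + \<beta> + s + of_nat (n - i)) i / fact i
        = (\<Sum>k\<le>i. pochhammer (\<beta> + s) k / fact k * (pochhammer (\<alpha> + of_nat (n - i)) (i - k) / fact (i - k)))"
      by (subst pochhammer_Vandermonde[symmetric]) (simp add: add_ac)
    then have "pochhammer s i * (pochhammer \<alpha> (n - i) * pochhammer \<beta> (n - i) / fact (n - i))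
        * (pochhammer (\<alpha> + \<beta> + s + of_nat (n - i)) i / fact i) = (\<Sum>k\<le>i. ?g i k)"
      by (simp only: sum_distrib_left)
    then show "pochhammer s i / fact i * (pochhammer \<alpha> (n - i) * pochhammer \<beta> (n - i) / fact (n - i))
            * pochhammer (\<alpha> + \<beta> + s + of_nat (n - i)) i = (\<Sum>k\<le>i. ?g i k)"
      by (simp add: mult_ac)
  qed simp
  also have "\<dots> = (\<Sum>k\<le>n. \<Sum>j\<le>n - k. ?g (k + j) k)"
    by (rule sum_triangle_reindex)
  also have "\<dots> = (\<Sum>k\<le>n. pochhammer (\<beta> + s) n * (pochhammer s k / fact k * (pochhammer \<alpha> (n - k) / fact (n - k))))"
  proof (rule sum.cong)
    fix k assume "k \<in> {..n}"
    then have k: "k \<le> n" by simp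
    \<comment> \<open>With \<open>i = k + j\<close> the two factors in \<alpha> merge into
      \<open>pochhammer \<alpha> (n - k)\<close>, which is free of \<open>j\<close>; the sum over
      \<open>j\<close> is then Vandermonde's in \<open>s + k\<close> and \<beta>.\<close>
    have "?g (k + j) k = pochhammer (\<beta> + s) k / fact k * pochhammer s k * pochhammer \<alpha> (n - k)
        * (pochhammer (s + of_nat k) j / fact j * (pochhammer \<beta> (n - k - j) / fact (n - k - j)))"
      if "j \<le> n - k" for j
    proof -
      have "pochhammer \<alpha> (n - k) = pochhammer \<alpha> (n - (k + j)) * pochhammer (\<alpha> + of_nat (n - (k + j))) j"
        using that k by (subst pochhammer_product'[symmetric]) simp
      then show ?thesis
        by (simp add: pochhammer_product'[of s k j] mult_ac)
    qed
    then have "(\<Sum>j\<le>n - k. ?g (k + j) k) = pochhammer (\<beta> + s) k / fact k * pochhammer s k * pochhammer \<alpha> (n - k)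
        * (pochhammer (s + of_nat k + \<beta>) (n - k) / fact (n - k))"
      unfolding pochhammer_Vandermonde sum_distrib_left by (intro sum.cong) auto
    \<comment> \<open>The value of the inner sum completes \<open>pochhammer (\<beta> + s) k\<close>
      to index \<open>n\<close>; what remains over \<open>k\<close> is Vandermonde's sum in
      \<open>s\<close> and \<alpha>.\<close>
    moreover have "pochhammer (\<beta> + s) n = pochhammer (\<beta> + s) k * pochhammer (s + of_nat k + \<beta>) (n - k)"
      using k pochhammer_product[of k n "\<beta> + s"] by (simp add: add_ac)
    ultimately show "(\<Sum>j\<le>n - k. ?g (k + j) k)
        = pochhammer (\<beta> + s) n * (pochhammer s k / fact k * (pochhammer \<alpha> (n - k) / fact (n - k)))"
      by simp
  qed simp
  also have "\<dots> = pochhammer (\<beta> + s) n * (pochhammer (s + \<alpha>) n / fact n)"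
    by (simp only: sum_distrib_left pochhammer_Vandermonde)
  finally show ?thesis by (simp add: add_ac mult_ac)
qed

text \<open>Expanding the last factor in the binomial coefficients of \<open>M\<close> reduces each of them to
  Saalschuetz's sum with \<open>s + j\<close> in place of \<open>s\<close>.\<close>

lemma Saalschuetz_shifted:
  fixes s \<alpha> \<beta> M :: "'a::field_char_0"
  shows "(\<Sum>i\<le>n. pochhammer s i / fact i * (pochhammer \<alpha> (n - i) * pochhammer \<beta> (n - i) / fact (n - i))
            * pochhammer (\<alpha> + \<beta> + s + M + of_nat (n - i)) i)
    = (\<Sum>j\<le>n. (M gchoose j) * pochhammer s j * (pochhammer (\<alpha> + s + of_nat j) (n - j)
            * pochhammer (\<beta> + s + of_nat j) (n - j) / fact (n - j)))"
proof -
  let ?g = "\<lambda>i j. pochhammer s i * (pochhammer \<alpha> (n - i) * pochhammer \<beta> (n - i) / fact (n - i))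
       * ((M gchoose j) * (pochhammer (\<alpha> + \<beta> + s + of_nat (n - i) + of_nat j) (i - j) / fact (i - j)))"
  have "(\<Sum>i\<le>n. pochhammer s i / fact i * (pochhammer \<alpha> (n - i) * pochhammer \<beta> (n - i) / fact (n - i))
            * pochhammer (\<alpha> + \<beta> + s + M + of_nat (n - i)) i) = (\<Sum>i\<le>n. \<Sum>j\<le>i. ?g i j)"
  proof (rule sum.cong)
    fix i
    have "pochhammer s i * (pochhammer \<alpha> (n - i) * pochhammer \<beta> (n - i) / fact (n - i))
        * (pochhammer (M + (\<alpha> + \<beta> + s + of_nat (n - i))) i / fact i) = (\<Sum>j\<le>i. ?g i j)"
      by (subst pochhammer_add_gbinomial) (rule sum_distrib_left)
    then show "pochhammer s i / fact i * (pochhammer \<alpha> (n - i) * pochhammer \<beta> (n - i) / fact (n - i))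
            * pochhammer (\<alpha> + \<beta> + s + M + of_nat (n - i)) i = (\<Sum>j\<le>i. ?g i j)"
      by (simp add: add_ac mult_ac)
  qed simp
  also have "\<dots> = (\<Sum>j\<le>n. \<Sum>i\<le>n - j. ?g (j + i) j)"
    by (rule sum_triangle_reindex)
  also have "\<dots> = (\<Sum>j\<le>n. (M gchoose j) * pochhammer s j * (pochhammer (\<alpha> + (s + of_nat j)) (n - j)
            * pochhammer (\<beta> + (s + of_nat j)) (n - j) / fact (n - j)))"
    unfolding Saalschuetz[symmetric] sum_distrib_left
    by (intro sum.cong refl) (simp add: pochhammer_product' add_ac mult_ac)
  finally show ?thesis by (simp add: add_ac)
qed

section \<open>Falling factorials\<close>

text \<open>\<open>(-1) ^ j * pochhammer (- of_nat k) j\<close> is the falling factorial of \<open>k\<close>.\<close>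

lemma Stirling_neg_pochhammer:
  fixes k :: nat
  shows "of_nat k ^ n = (\<Sum>j\<le>n. of_nat (Stirling n j) * ((-1) ^ j * pochhammer (- of_nat k :: 'a::comm_ring_1) j))"
proof (induction n)
  case (Suc n)
  define f where "f j = (-1) ^ j * pochhammer (- of_nat k :: 'a) j" for j
  \<comment> \<open>This is \<open>k = (k - j) + j\<close> times \<open>f j\<close>; it mirrors the
    recurrence of the Stirling numbers.\<close>
  have f: "of_nat k * f j = f (Suc j) + of_nat j * f j" for j
    by (simp add: f_def pochhammer_Suc algebra_simps)
  have "of_nat k ^ Suc n = (\<Sum>j\<le>n. of_nat (Stirling n j) * (of_nat k * f j))"
    by (simp add: Suc.IH sum_distrib_left f_def mult_ac)
  also have "\<dots> = (\<Sum>j\<le>n. of_nat (Stirling n j) * f (Suc j)) + (\<Sum>j\<le>n. of_nat (j * Stirling n j) * f j)"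
    by (simp add: f sum.distrib distrib_left mult_ac)
  \<comment> \<open>The added term is zero because \<open>Stirling n (Suc n) = 0\<close>. The term
    at \<open>j = 0\<close> is zero too, so the index can be shifted next.\<close>
  also have "(\<Sum>j\<le>n. of_nat (j * Stirling n j) * f j) = (\<Sum>j\<le>Suc n. of_nat (j * Stirling n j) * f j)"
    by simp
  also have "\<dots> = (\<Sum>j\<le>n. of_nat (Suc j * Stirling n (Suc j)) * f (Suc j))"
    by (subst sum.atMost_Suc_shift) simp
  also have "(\<Sum>j\<le>n. of_nat (Stirling n j) * f (Suc j)) + \<dots> = (\<Sum>j\<le>n. of_nat (Stirling (Suc n) (Suc j)) * f (Suc j))"
    unfolding sum.distrib[symmetric] by (intro sum.cong refl) (simp add: algebra_simps)
  also have "\<dots> = (\<Sum>j\<le>Suc n. of_nat (Stirling (Suc n) j) * f j)"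
    by (subst sum.atMost_Suc_shift) simp
  finally show ?case by (simp only: f_def)
qed simp

lemma neg_pochhammer_of_nat:
  assumes "j \<le> n"
  shows "(-1) ^ j * pochhammer (- of_nat n :: 'a::field_char_0) j = fact n / fact (n - j)"
proof -
  have "fact n = fact (n - j) * pochhammer (1 + of_nat (n - j) :: 'a) j"
    unfolding pochhammer_fact using assms pochhammer_product[of "n - j" n "1::'a"] by simp
  then show ?thesis
    using assms by (simp add: pochhammer_minus of_nat_diff add_ac diff_add_eq flip: power_mult_distrib)
qed

section \<open>Coefficients of the product for a single shifted Gauss series\<close>

text \<open>This is \<open>Saalschuetz_shifted\<close> with \<open>\<alpha> = a + j\<close>,
  \<open>\<beta> = b + j\<close>, \<open>M = m - j\<close> and \<open>n = N - j\<close>. Since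
  \<open>M\<close> is a natural number, at most \<open>m - j + 1\<close> terms survive on its right
  side for any \<open>N\<close>, and they make up \<open>G_fun\<close>.\<close>

lemma Euler_coefficient:
  fixes a b c :: complex
  assumes j: "j \<le> m"
    and \<lambda>: "pochhammer (c - a - of_nat m) m \<noteq> 0" and \<mu>: "pochhammer (c - b - of_nat m) m \<noteq> 0"
    and c: "pochhammer c N \<noteq> 0"
  shows "(\<Sum>i\<le>N. pochhammer (c - a - b - of_nat m) i / fact i
        * (pochhammer a (N - i) * pochhammer b (N - i) / (pochhammer c (N - i) * fact (N - i))
          * ((-1) ^ j * pochhammer (- of_nat (N - i)) j)))
    = pochhammer (c - a - of_nat m) N * pochhammer (c - b - of_nat m) N / (pochhammer c N * fact N)
        * ((-1) ^ j * pochhammer a j * pochhammer b j * pochhammer (- of_nat N) j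
          / (pochhammer (c - a - of_nat m) j * pochhammer (c - b - of_nat m) j)
          * G_fun a b c m j (- of_nat N))"
    (is "?lhs = ?rhs")
proof (cases "j \<le> N")
  \<comment> \<open>For \<open>N < j\<close> the falling factorials of \<open>N\<close> and of all
    \<open>N - i\<close> of order \<open>j\<close> vanish, so both sides are zero.\<close>
  case False
  then show ?thesis
    by (auto simp: pochhammer_of_nat_eq_0_lemma simp del: of_nat_diff intro!: sum.neutral)
next
  case True
  define s u v L where "s = c - a - b - of_nat m" and "u = c - a - of_nat m"
    and "v = c - b - of_nat m" and "L = N - j"
  define T where "T i = (of_nat (m - j) gchoose i) * pochhammer s i
      * (pochhammer (v + of_nat j + of_nat i) (L - i) * pochhammer (u + of_nat j + of_nat i) (L - i)
        / fact (L - i))" for i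
  have N: "N = j + L" using True by (simp add: L_def)
  have "?lhs = (\<Sum>i\<le>L. pochhammer s i / fact i
        * (pochhammer a (N - i) * pochhammer b (N - i) / (pochhammer c (N - i) * fact (N - i))
          * ((-1) ^ j * pochhammer (- of_nat (N - i)) j)))"
    unfolding s_def by (rule sum.mono_neutral_right) (auto simp: N pochhammer_of_nat_eq_0_lemma simp del: of_nat_diff)
  also have "\<dots> = (\<Sum>i\<le>L. pochhammer a j * pochhammer b j / pochhammer c N * (pochhammer s i / fact i
        * (pochhammer (a + of_nat j) (L - i) * pochhammer (b + of_nat j) (L - i) / fact (L - i))
        * pochhammer ((a + of_nat j) + (b + of_nat j) + s + of_nat (m - j) + of_nat (L - i)) i))"
  proof (rule sum.cong)
    fix i assume "i \<in> {..L}"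
    then have i: "i \<le> L" by simp
    \<comment> \<open>The excess \<open>m - j\<close> is what turns the last argument into
      \<open>c + (N - i)\<close>, so that \<open>pochhammer c N\<close> can be taken out of the sum
      as a common denominator.\<close>
    have e: "(a + of_nat j) + (b + of_nat j) + s + of_nat (m - j) + of_nat (L - i) = c + of_nat (N - i)"
      using i j by (simp add: N s_def of_nat_diff)
    have cN: "pochhammer c N = pochhammer c (N - i) * pochhammer (c + of_nat (N - i)) i"
      using i N by (subst pochhammer_product'[symmetric]) simp
    with c have nz: "pochhammer (c + of_nat (N - i)) i \<noteq> 0" "pochhammer c (N - i) \<noteq> 0" by auto
    have Ni: "N - i = j + (L - i)" using i N by simp
    have "(-1) ^ j * pochhammer (- of_nat (N - i) :: complex) j = fact (N - i) / fact (L - i)"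
      by (subst neg_pochhammer_of_nat) (simp_all add: Ni)
    moreover have "pochhammer x (N - i) = pochhammer x j * pochhammer (x + of_nat j) (L - i)" for x :: complex
      by (simp add: Ni pochhammer_product')
    ultimately show "pochhammer s i / fact i
        * (pochhammer a (N - i) * pochhammer b (N - i) / (pochhammer c (N - i) * fact (N - i))
          * ((-1) ^ j * pochhammer (- of_nat (N - i)) j))
      = pochhammer a j * pochhammer b j / pochhammer c N * (pochhammer s i / fact i
        * (pochhammer (a + of_nat j) (L - i) * pochhammer (b + of_nat j) (L - i) / fact (L - i))
        * pochhammer ((a + of_nat j) + (b + of_nat j) + s + of_nat (m - j) + of_nat (L - i)) i)"
      unfolding e cN using nz by (simp add: mult_ac)
  qed simp
  also have "\<dots> = pochhammer a j * pochhammer b j / pochhammer c N * (\<Sum>i\<le>L. T i)"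
  proof -
    have "a + of_nat j + s = v + of_nat j" "b + of_nat j + s = u + of_nat j"
      by (simp_all add: u_def v_def s_def)
    then show ?thesis
      by (simp only: sum_distrib_left[symmetric] Saalschuetz_shifted T_def)
  qed
  also have "pochhammer a j * pochhammer b j / pochhammer c N * (\<Sum>i\<le>L. T i) = ?rhs"
  proof -
    \<comment> \<open>\<open>K\<close> is the value \<open>T 0\<close>, since
      \<open>pochhammer u N / pochhammer u j\<close> is \<open>pochhammer (u + of_nat j) L\<close>,
      and likewise for \<open>v\<close>.\<close>
    define K where "K = pochhammer u N * pochhammer v N / (pochhammer u j * pochhammer v j * fact L)"
    define h where "h i = hyp_term [- of_nat m + of_nat j, - of_nat N + of_nat j, s]
        [u + of_nat j, v + of_nat j] 1 i" for i
    have mj: "- of_nat m + of_nat j = - (of_nat (m - j) :: complex)"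
      and Nj: "- of_nat N + of_nat j = - (of_nat L :: complex)"
      using j N by (simp_all add: of_nat_diff)
    \<comment> \<open>The ranges differ, but beyond \<open>L\<close> the numerator parameter
      \<open>-L\<close> kills \<open>h i\<close>, and beyond \<open>m - j\<close> the binomial
      coefficient kills \<open>T i\<close>.\<close>
    have "(\<Sum>i\<le>L. T i) = (\<Sum>i\<le>m - j. K * h i)"
    proof (rule sum.mono_neutral_cong)
      fix i assume "i \<in> {..m - j} - {..L}"
      then show "K * h i = 0"
        unfolding h_def Nj hyp_term_def by (simp add: pochhammer_of_nat_eq_0_lemma)
    next
      fix i assume "i \<in> {..L} - {..m - j}"
      then show "T i = 0"
        by (simp add: T_def flip: binomial_gbinomial)
    next
      fix i assume "i \<in> {..L} \<inter> {..m - j}"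
      then have i: "i \<le> L" "j + i \<le> m" using j by auto
      have N': "N = j + i + (L - i)" using i(1) N by simp
      have split: "pochhammer w N = pochhammer w j * pochhammer (w + of_nat j) i
          * pochhammer (w + of_nat j + of_nat i) (L - i)" for w :: complex
        unfolding N' pochhammer_product' by (simp add: add_ac)
      have nz: "pochhammer w j \<noteq> 0 \<and> pochhammer (w + of_nat j) i \<noteq> 0"
        if "pochhammer w m \<noteq> 0" for w :: complex
        using pochhammer_neq_0_mono[OF that i(2)] by (simp add: pochhammer_product')
      \<comment> \<open>The signs \<open>(-1) ^ i\<close> of the two falling factorials
        cancel.\<close>
      have "pochhammer (- of_nat (m - j) :: complex) i * pochhammer (- of_nat L) i
          = (of_nat (m - j) gchoose i) * (fact i * (fact L / fact (L - i)))"
        unfolding gbinomial_pochhammer neg_pochhammer_of_nat[OF i(1), symmetric]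
        by (simp flip: power_mult_distrib)
      then have "pochhammer (- of_nat (m - j) :: complex) i * (pochhammer (- of_nat L) i * pochhammer s i)
          = (of_nat (m - j) gchoose i) * (fact i * (fact L / fact (L - i))) * pochhammer s i"
        by (metis mult.assoc)
      then show "T i = K * h i"
        using nz[OF \<lambda>[folded u_def]] nz[OF \<mu>[folded v_def]]
        unfolding T_def K_def h_def split hyp_term_def mj Nj
        by simp
    qed (auto)
    then have "(\<Sum>i\<le>L. T i) = K * G_fun a b c m j (- of_nat N)"
      by (simp add: G_fun_def h_def sum_distrib_left u_def v_def s_def)
    moreover have "(-1) ^ j * pochhammer (- of_nat N :: complex) j = fact N / fact L"
      unfolding L_def by (rule neg_pochhammer_of_nat[OF True])
    then have "(-1) ^ j * pochhammer a j * pochhammer b j * pochhammer (- of_nat N) j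
        = pochhammer a j * pochhammer b j * fact N / fact L"
      by (metis (no_types, opaque_lifting) mult.commute mult.left_commute times_divide_eq_right)
    ultimately show ?thesis
      by (simp add: K_def u_def v_def) (simp add: mult_ac)
  qed
  finally show ?thesis .
qed

section \<open>Expansion of the quotients in the \<open>fs\<close> parameters\<close>

lemma poly_prod_list_map: "poly (\<Prod>x\<leftarrow>xs. f x) y = (\<Prod>x\<leftarrow>xs. poly (f x) y)"
  by (induction xs) auto

lemma degree_pochhammer_le: "degree (pochhammer [:f, 1 :: 'a::comm_ring_1:] l) \<le> l"
proof (induction l)
  case (Suc l)
  have "degree ([:f, 1:] + of_nat l) \<le> 1"
    by (intro degree_add_le) auto
  with Suc show ?case
    unfolding pochhammer_Suc by (intro order.trans[OF degree_mult_le]) simp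
qed simp

lemma degree_prod_pochhammer_le:
  assumes "length fs = length ms"
  shows "degree (\<Prod>(f, l)\<leftarrow>zip fs ms. pochhammer [:f, 1 :: 'a::comm_ring_1:] l) \<le> sum_list ms"
  using assms
proof (induction fs ms rule: list_induct2)
  case (Cons f fs l ms)
  show ?case
    using Cons.IH degree_pochhammer_le[of f l] by (simp add: order.trans[OF degree_mult_le])
qed simp

text \<open>The product is a polynomial in \<open>k\<close> with coefficients \<open>sigma\<close>.
  Writing each power of \<open>k\<close> in falling factorials and exchanging the sums collects the
  Stirling sums that define \<open>C_coeff\<close>.\<close>

lemma prod_pochhammer_eq_C_coeff:
  fixes fs :: "complex list" and k :: nat
  assumes "length fs = length ms"
  shows "(\<Prod>(f, l)\<leftarrow>zip fs ms. pochhammer (f + of_nat k) l) / Lam fs ms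
    = (\<Sum>j\<le>sum_list ms. C_coeff fs ms j * ((-1) ^ j * pochhammer (- of_nat k) j))"
proof -
  define q where "q = (\<Prod>(f, l)\<leftarrow>zip fs ms. pochhammer [:f, 1 :: complex:] l)"
  let ?m = "sum_list ms"
  let ?e = "\<lambda>j. (-1) ^ j * pochhammer (- of_nat k :: complex) j"
  have "(\<Prod>(f, l)\<leftarrow>zip fs ms. pochhammer (f + of_nat k) l) = poly q (of_nat k)"
    unfolding q_def
    by (simp add: poly_prod_list_map poly_pochhammer case_prod_unfold)
  also have "\<dots> = (\<Sum>i\<le>?m. coeff q i * of_nat k ^ i)"
    unfolding poly_altdef using degree_prod_pochhammer_le[OF assms]
    by (intro sum.mono_neutral_left) (auto simp: q_def coeff_eq_0)
  also have "\<dots> = (\<Sum>i\<le>?m. \<Sum>j\<le>?m. sigma fs ms i * of_nat (Stirling i j) * ?e j)"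
  proof (rule sum.cong)
    fix i assume "i \<in> {..?m}"
    \<comment> \<open>Since \<open>Stirling i j = 0\<close> for \<open>j > i\<close>, all powers can
      share one range of \<open>j\<close>, which makes the later exchange of sums
      rectangular.\<close>
    then have "(\<Sum>j\<le>?m. of_nat (Stirling i j) * ?e j) = (\<Sum>j\<le>i. of_nat (Stirling i j) * ?e j)"
      by (intro sum.mono_neutral_right) auto
    then have "of_nat k ^ i = (\<Sum>j\<le>?m. of_nat (Stirling i j) * ?e j)"
      by (subst Stirling_neg_pochhammer) simp
    then show "coeff q i * of_nat k ^ i = (\<Sum>j\<le>?m. sigma fs ms i * of_nat (Stirling i j) * ?e j)"
      by (simp add: sigma_def q_def sum_distrib_left mult.assoc)
  qed simp
  also have "\<dots> = (\<Sum>j\<le>?m. (\<Sum>i\<le>?m. sigma fs ms i * of_nat (Stirling i j)) * ?e j)"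
    by (subst sum.swap) (simp add: sum_distrib_right)
  also have "\<dots> = (\<Sum>j\<le>?m. (\<Sum>i=j..?m. sigma fs ms i * of_nat (Stirling i j)) * ?e j)"
    by (intro sum.cong refl arg_cong2[of _ _ _ _ times] sum.mono_neutral_right) auto
  finally show ?thesis
    by (simp only: C_coeff_def sum_divide_distrib) (intro sum.cong refl, simp)
qed

lemma Lam_nonzero:
  assumes "\<forall>f\<in>set fs. f \<notin> \<int>\<^sub>\<le>\<^sub>0"
  shows "Lam fs ms \<noteq> 0"
  using assms unfolding Lam_def
  by (auto simp: prod_list_zero_iff dest!: set_zip_leftD pochhammer_eq_0_imp_nonpos_Int)

text \<open>At \<open>k = 0\<close> only the falling factorial of order zero survives in the
  expansion.\<close>

lemma C_coeff_0:
  assumes "length fs = length ms" "\<forall>f\<in>set fs. f \<notin> \<int>\<^sub>\<le>\<^sub>0"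
  shows "C_coeff fs ms 0 = 1"
proof -
  have "1 = (\<Sum>j\<le>sum_list ms. C_coeff fs ms j * ((-1) ^ j * pochhammer 0 j))"
    using prod_pochhammer_eq_C_coeff[OF assms(1), of 0] Lam_nonzero[OF assms(2), of ms]
    by (simp add: Lam_def)
  also have "\<dots> = (\<Sum>j\<le>sum_list ms. if j = 0 then C_coeff fs ms 0 else 0)"
    by (intro sum.cong) (auto simp: pochhammer_0_left)
  also have "\<dots> = C_coeff fs ms 0"
    by simp
  finally show ?thesis ..
qed

text \<open>Splitting \<open>pochhammer f (l + k)\<close> after \<open>l\<close> or after
  \<open>k\<close> factors turns each quotient into a polynomial in the summation index.\<close>

lemma prod_pochhammer_quotient:
  fixes fs :: "complex list"
  assumes "length fs = length ms" "\<forall>f\<in>set fs. f \<notin> \<int>\<^sub>\<le>\<^sub>0"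
  shows "(\<Prod>a\<leftarrow>map2 (\<lambda>f l. f + of_nat l) fs ms. pochhammer a k) / (\<Prod>f\<leftarrow>fs. pochhammer f k)
    = (\<Prod>(f, l)\<leftarrow>zip fs ms. pochhammer (f + of_nat k) l) / Lam fs ms"
  using assms
proof (induction fs ms rule: list_induct2)
  case (Cons f fs l ms)
  have "pochhammer (f + of_nat l) k / pochhammer f k = pochhammer (f + of_nat k) l / pochhammer f l"
  proof -
    have "pochhammer f l * pochhammer (f + of_nat l) k = pochhammer f k * pochhammer (f + of_nat k) l"
      using pochhammer_product'[of f l k] pochhammer_product'[of f k l] by (metis add.commute)
    moreover have "pochhammer f l \<noteq> 0" "pochhammer f k \<noteq> 0"
      using Cons.prems by (auto dest: pochhammer_eq_0_imp_nonpos_Int)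
    ultimately show ?thesis by (simp add: frac_eq_eq mult.commute)
  qed
  moreover have "(\<Prod>a\<leftarrow>map2 (\<lambda>f l. f + of_nat l) fs ms. pochhammer a k) / (\<Prod>f\<leftarrow>fs. pochhammer f k)
      = (\<Prod>(f, l)\<leftarrow>zip fs ms. pochhammer (f + of_nat k) l) / Lam fs ms"
    using Cons by simp
  ultimately have "pochhammer (f + of_nat l) k / pochhammer f k
      * ((\<Prod>a\<leftarrow>map2 (\<lambda>f l. f + of_nat l) fs ms. pochhammer a k) / (\<Prod>f\<leftarrow>fs. pochhammer f k))
    = pochhammer (f + of_nat k) l / pochhammer f l
      * ((\<Prod>(f, l)\<leftarrow>zip fs ms. pochhammer (f + of_nat k) l) / Lam fs ms)"
    by (simp only:)
  then show ?case
    by (simp add: Lam_def)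
qed (simp add: Lam_def)

section \<open>Normalisation and zeros of the polynomial\<close>

lemma Q_fun_0:
  assumes "length fs = length ms" "\<forall>f\<in>set fs. f \<notin> \<int>\<^sub>\<le>\<^sub>0"
  shows "Q_fun a b c fs ms 0 = 1"
proof -
  have "G_fun a b c m 0 0 = 1" for m
  proof -
    have "G_fun a b c m 0 0 = (\<Sum>i\<le>m. if i = 0 then 1 else 0)"
      unfolding G_fun_def by (intro sum.cong) (auto simp: hyp_term_def pochhammer_0_left)
    then show ?thesis by simp
  qed
  moreover have "Q_fun a b c fs ms 0
      = (\<Sum>k\<le>sum_list ms. if k = 0 then C_coeff fs ms 0 * G_fun a b c (sum_list ms) 0 0 else 0)"
    unfolding Q_fun_def Let_def by (intro sum.cong) (auto simp: pochhammer_0_left)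
  ultimately show ?thesis
    by (simp add: C_coeff_0[OF assms])
qed

lemma prod_unit_shift_proots:
  fixes q :: "complex poly"
  assumes "mset etas = proots q" "poly q 0 = 1"
  shows "(\<Prod>\<eta>\<leftarrow>etas. (\<eta> + k) / \<eta>) = poly q (- k)"
proof -
  have P: "poly q t = lead_coeff q * (\<Prod>\<eta>\<leftarrow>etas. t - \<eta>)" for t
  proof -
    have "q = smult (lead_coeff q) (\<Prod>\<eta>\<leftarrow>etas. [:-\<eta>, 1:])"
      using complex_poly_decompose_multiset[of q]
      by (metis assms(1) mset_map prod_mset_prod_list)
    then have "poly q t = poly (smult (lead_coeff q) (\<Prod>\<eta>\<leftarrow>etas. [:-\<eta>, 1:])) t"
      by simp
    then show ?thesis by (simp add: poly_prod_list_map)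
  qed
  have "(\<Prod>\<eta>\<leftarrow>etas. (\<eta> + k) / \<eta>) * (\<Prod>\<eta>\<leftarrow>etas. 0 - \<eta>) = (\<Prod>\<eta>\<leftarrow>etas. - k - \<eta>)"
  proof -
    \<comment> \<open>The condition \<open>poly q 0 = 1\<close> rules out the root zero, so the
      divisions by \<eta> cancel.\<close>
    have "(\<Prod>\<eta>\<leftarrow>etas. 0 - \<eta>) \<noteq> 0" using P[of 0] assms(2) by auto
    then have "0 \<notin> set etas" by (auto simp: prod_list_zero_iff)
    then show ?thesis
      unfolding prod_list_mult[symmetric]
      by (intro arg_cong[of _ _ prod_list] map_cong) auto
  qed
  \<comment> \<open>The inserted factor is \<open>poly q 0 = 1\<close>; it supplies the leading
    coefficient.\<close>
  moreover have "(\<Prod>\<eta>\<leftarrow>etas. (\<eta> + k) / \<eta>)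
      = lead_coeff q * ((\<Prod>\<eta>\<leftarrow>etas. (\<eta> + k) / \<eta>) * (\<Prod>\<eta>\<leftarrow>etas. 0 - \<eta>))"
    using P[of 0] assms(2) by (simp add: mult.left_commute)
  ultimately show ?thesis by (simp only: P)
qed

section \<open>The Cauchy product and the transformation\<close>

lemma hyp_term_Cauchy_coefficient:
  fixes a b c :: complex and fs ms
  defines "m \<equiv> sum_list ms"
  assumes len: "length fs = length ms" and f: "\<forall>f\<in>set fs. f \<notin> \<int>\<^sub>\<le>\<^sub>0"
    and \<lambda>: "pochhammer (c - a - of_nat m) m \<noteq> 0" and \<mu>: "pochhammer (c - b - of_nat m) m \<noteq> 0"
    and c: "pochhammer c N \<noteq> 0"
  shows "(\<Sum>i\<le>N. pochhammer (c - a - b - of_nat m) i / fact i * z ^ i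
        * hyp_term ([b, a] @ map2 (\<lambda>f l. f + of_nat l) fs ms) (c # fs) z (N - i))
    = hyp_term [c - a - of_nat m, c - b - of_nat m] [c] z N * Q_fun a b c fs ms (- of_nat N)"
proof -
  let ?P = "\<lambda>i. pochhammer (c - a - b - of_nat m) i / fact i"
  let ?H = "\<lambda>k. pochhammer a k * pochhammer b k / (pochhammer c k * fact k)"
  let ?e = "\<lambda>j k. (-1) ^ j * pochhammer (- of_nat k :: complex) j"
  have H: "hyp_term ([b, a] @ map2 (\<lambda>f l. f + of_nat l) fs ms) (c # fs) z k
      = (\<Sum>j\<le>m. C_coeff fs ms j * (?H k * ?e j k)) * z ^ k" for k
  proof -
    have "hyp_term ([b, a] @ map2 (\<lambda>f l. f + of_nat l) fs ms) (c # fs) z k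
      = ?H k * ((\<Prod>a\<leftarrow>map2 (\<lambda>f l. f + of_nat l) fs ms. pochhammer a k) / (\<Prod>f\<leftarrow>fs. pochhammer f k)) * z ^ k"
      by (simp add: hyp_term_def mult_ac)
    also have "\<dots> = (\<Sum>j\<le>m. C_coeff fs ms j * (?H k * ?e j k)) * z ^ k"
      unfolding prod_pochhammer_quotient[OF len f] prod_pochhammer_eq_C_coeff[OF len] m_def sum_distrib_left
      by (simp add: mult_ac)
    finally show ?thesis .
  qed
  have "(\<Sum>i\<le>N. ?P i * z ^ i
        * hyp_term ([b, a] @ map2 (\<lambda>f l. f + of_nat l) fs ms) (c # fs) z (N - i))
      = (\<Sum>i\<le>N. \<Sum>j\<le>m. z ^ N * C_coeff fs ms j * (?P i * (?H (N - i) * ?e j (N - i))))"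
  proof (rule sum.cong)
    fix i assume "i \<in> {..N}"
    then have "z ^ N = z ^ i * z ^ (N - i)" by (simp flip: power_add)
    then show "?P i * z ^ i
        * hyp_term ([b, a] @ map2 (\<lambda>f l. f + of_nat l) fs ms) (c # fs) z (N - i)
      = (\<Sum>j\<le>m. z ^ N * C_coeff fs ms j * (?P i * (?H (N - i) * ?e j (N - i))))"
      unfolding H by (simp add: sum_distrib_left sum_distrib_right mult_ac)
  qed simp
  \<comment> \<open>After the exchange each inner sum is the left side of
    \<open>Euler_coefficient\<close>.\<close>
  also have "\<dots> = (\<Sum>j\<le>m. z ^ N * C_coeff fs ms j * (\<Sum>i\<le>N. ?P i * (?H (N - i) * ?e j (N - i))))"
    by (subst sum.swap) (simp add: sum_distrib_left)
  also have "\<dots> = hyp_term [c - a - of_nat m, c - b - of_nat m] [c] z N * Q_fun a b c fs ms (- of_nat N)"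
    unfolding Q_fun_def Let_def m_def[symmetric]
      sum_distrib_left[where r = "hyp_term [c - a - of_nat m, c - b - of_nat m] [c] z N"]
  proof (rule sum.cong)
    fix j assume "j \<in> {..m}"
    then have "j \<le> m" by simp
    then show "z ^ N * C_coeff fs ms j * (\<Sum>i\<le>N. ?P i * (?H (N - i) * ?e j (N - i)))
      = hyp_term [c - a - of_nat m, c - b - of_nat m] [c] z N
        * ((-1) ^ j * C_coeff fs ms j * pochhammer a j * pochhammer b j * pochhammer (- of_nat N) j
          / (pochhammer (c - a - of_nat m) j * pochhammer (c - b - of_nat m) j)
          * G_fun a b c m j (- of_nat N))"
      by (subst Euler_coefficient[OF _ \<lambda> \<mu> c]) (simp_all add: hyp_term_def mult_ac)
  qed simp
  finally show ?thesis .
qed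

text \<open>The Cauchy product needs absolute convergence. It follows at \<open>z\<close> because
  the same power series converges at a real \<open>w\<close> with
  \<open>norm z < w < 1\<close>.\<close>

lemma summable_norm_hyp_term:
  assumes "length as = Suc (length bs)" "norm z < 1"
  shows "summable (\<lambda>k. norm (hyp_term as bs z k))"
proof -
  obtain w :: real where w: "norm z < w" "w < 1" using assms(2) dense by blast
  let ?g = "\<lambda>k. (\<Prod>a\<leftarrow>as. pochhammer a k) / (\<Prod>b\<leftarrow>bs. pochhammer b k) / fact k"
  have g: "hyp_term as bs y = (\<lambda>k. ?g k * y ^ k)" for y
    by (simp add: hyp_term_def fun_eq_iff)
  have w': "norm (of_real w :: complex) = w"
    using order.trans[OF norm_ge_zero[of z] less_imp_le[OF w(1)]] by simp
  then have "summable (\<lambda>k. ?g k * of_real w ^ k)"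
    using summable_hyp_term[OF assms(1), of "of_real w"] w(2) unfolding g by simp
  then show ?thesis
    unfolding g using w(1) w' by (intro powser_insidea) auto
qed

text \<open>The extended Euler transformation of Miller and Paris; \<open>theorem2\<close> is its case
  \<open>c - a - b - m = 1 / 2\<close>.\<close>

theorem hypF_Euler_transformation:
  fixes a b c z :: complex and fs etas :: "complex list" and ms :: "nat list"
  defines "m \<equiv> sum_list ms"
  assumes len: "length fs = length ms" and f: "\<forall>f\<in>set fs. f \<notin> \<int>\<^sub>\<le>\<^sub>0"
    and \<lambda>: "pochhammer (c - a - of_nat m) m \<noteq> 0" and \<mu>: "pochhammer (c - b - of_nat m) m \<noteq> 0"
    and c: "c \<notin> \<int>\<^sub>\<le>\<^sub>0"
    and etas: "mset etas = proots (Q_poly a b c fs ms)"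
    and z: "norm z < 1"
  shows "(1 - z) powr (- (c - a - b - of_nat m))
      * hypF ([b, a] @ map2 (\<lambda>f l. f + of_nat l) fs ms) (c # fs) z
    = hypF_unit_shift [c - a - of_nat m, c - b - of_nat m] [c] etas z"
proof -
  let ?s = "c - a - b - of_nat m"
  let ?h = "hyp_term ([b, a] @ map2 (\<lambda>f l. f + of_nat l) fs ms) (c # fs) z"
  let ?p = "\<lambda>i. pochhammer ?s i / fact i * z ^ i"
  have "(\<lambda>i. (- ?s gchoose i) * (- z) ^ i) sums (1 + - z) powr (- ?s)"
    using z by (intro gen_binomial_complex) simp
  moreover have "(- ?s gchoose i) * (- z) ^ i = ?p i" for i
    by (simp add: gbinomial_pochhammer power_minus[of z] mult_ac)
  ultimately have binom: "(\<Sum>i. ?p i) = (1 - z) powr (- ?s)"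
    by (simp add: sums_iff)
  have "(\<lambda>N. \<Sum>i\<le>N. ?p i * ?h (N - i)) sums ((\<Sum>i. ?p i) * (\<Sum>k. ?h k))"
  proof (rule Cauchy_product_sums)
    show "summable (\<lambda>i. norm (?p i))"
      \<comment> \<open>The binomial series is the hypergeometric series with the single numerator
        parameter \<open>?s\<close> and no denominator parameter.\<close>
      using z summable_norm_hyp_term[of "[?s]" "[]" z] by (simp add: hyp_term_def)
    show "summable (\<lambda>k. norm (?h k))"
      using len z by (intro summable_norm_hyp_term) simp_all
  qed
  moreover have "(\<Sum>i\<le>N. ?p i * ?h (N - i))
      = hyp_unit_shift_term [c - a - of_nat m, c - b - of_nat m] [c] etas z N" for N
  proof -
    have "(\<Prod>\<eta>\<leftarrow>etas. (\<eta> + of_nat N) / \<eta>) = Q_fun a b c fs ms (- of_nat N)"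
      using prod_unit_shift_proots[OF etas, of "of_nat N"] Q_fun_0[OF len f]
      by (simp add: poly_Q_poly)
    moreover have "pochhammer c N \<noteq> 0"
      using c pochhammer_eq_0_imp_nonpos_Int by blast
    ultimately show ?thesis
      using hyp_term_Cauchy_coefficient[OF len f \<lambda>[unfolded m_def] \<mu>[unfolded m_def]]
      by (simp add: hyp_unit_shift_term_def m_def)
  qed
  ultimately show ?thesis
    by (simp only: binom hypF_def hypF_unit_shift_def sums_iff)
qed

theorem theorem2:
  fixes r m p :: nat and ms :: "nat list" and fs etas :: "complex list"
    and n a b c x :: complex
  assumes "length fs = r" and "length ms = r"
    and "\<forall>l\<in>set ms. 0 < l" and "m = sum_list ms"
    and "p \<in> {0, 1}"
    and "\<forall>f\<in>set fs. f \<notin> \<int>\<^sub>\<le>\<^sub>0"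
    and "a = n + of_nat p / 2" and "b = - n + of_nat p / 2"
    and "c = of_nat p + 1 / 2 + of_nat m"
    and "pochhammer (c - a - of_nat m) m \<noteq> 0" and "pochhammer (c - b - of_nat m) m \<noteq> 0"
    and "degree (Q_poly a b c fs ms) = m"
    and "mset etas = proots (Q_poly a b c fs ms)"
    and "norm x < 1"
  shows "(1 - x\<^sup>2) powr (- 1 / 2) *
      hypF ([- n + of_nat p / 2, n + of_nat p / 2] @ map2 (\<lambda>f l. f + of_nat l) fs ms)
           ((of_nat p + 1 / 2 + of_nat m) # fs) (x\<^sup>2)
    = hypF_unit_shift [1 / 2 + of_nat p / 2 - n, 1 / 2 + of_nat p / 2 + n]
           [of_nat p + 1 / 2 + of_nat m] etas (x\<^sup>2)"
proof -
  \<comment> \<open>Here \<open>a + b = p\<close>, so the exponent does not depend on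
    \<open>p\<close> or \<open>n\<close>.\<close>
  have e: "- (c - a - b - of_nat (sum_list ms)) = - 1 / 2"
    "c - a - of_nat (sum_list ms) = 1 / 2 + of_nat p / 2 - n"
    "c - b - of_nat (sum_list ms) = 1 / 2 + of_nat p / 2 + n"
    using assms(4,7-9) by (simp_all add: field_simps)
  have "c \<notin> \<int>\<^sub>\<le>\<^sub>0"
  proof
    assume "c \<in> \<int>\<^sub>\<le>\<^sub>0"
    then obtain k :: nat where "c = - of_nat k" by (auto elim!: nonpos_Ints_cases')
    then have "Re c \<le> 0" by simp
    then show False using assms(9) by simp
  qed
  moreover have "norm (x\<^sup>2) < 1"
    using assms(14) by (simp add: norm_power power_less_one_iff)
  ultimately have "(1 - x\<^sup>2) powr (- (c - a - b - of_nat (sum_list ms)))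
      * hypF ([b, a] @ map2 (\<lambda>f l. f + of_nat l) fs ms) (c # fs) (x\<^sup>2)
    = hypF_unit_shift [c - a - of_nat (sum_list ms), c - b - of_nat (sum_list ms)] [c] etas (x\<^sup>2)"
    using assms by (intro hypF_Euler_transformation) simp_all
  then show ?thesis
    unfolding e using assms(7-9) by simp
qed

end
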